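(* Let $\Omega=[-1,1]$, let $\mu$ be the Lebesgue measure on $\Omega$, and let $a>0$ and $A>B>0$ be real numbers such that $A^2>2a^2+B^2$. Define $f_1,f_2:\Omega\to\mathbb{R}$ by $$f_1(x)=\begin{cases}0,& -1\le x<0,\\ 1,& 0\le x\le 1,\end{cases}\qquad f_2(x)=\begin{cases}a,& -1\le x<0,\\ A,& 0\le x<1/4,\\ -A,& 1/4\le x<1/2,\\ B,& 1/2\le x<3/4,\\ -B,& 3/4\le x\le 1.\end{cases}$$ Let $X_2=\langle f_1,f_2\rangle\subset L_2(\Omega,\mu)$ be the real linear span of $f_1,f_2$. Then: (a) $m(X_2,w)=3$; (b) $X_2\in\mathcal{M}_+^w(3,2,0)$; (c) for $\xi^1=-1/2$, $\xi^2=1/8$, $\xi^3=3/8$, $\lambda_1=\dfrac{2a^2-A^2+B^2}{2a^2}<0$, $\lambda_2=\lambda_3=\dfrac12$, the equality $\displaystyle\int_\Omega f^2\,d\mu=\sum_{j=1}^3\lambda_j f^2(\xi^j)$ holds for all $f\in X_2$.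
   Context: Let $\Omega\subset\mathbb{R}^d$ be compact, $\mu$ a finite measure on $\Omega$, and $X_N=\langle f_1,\dots,f_N\rangle$ an $N$-dimensional linear subspace of the real space $L_2(\Omega,\mu)$, spanned by linearly independent functions $f_1,\dots,f_N$ that are defined everywhere on $\Omega$ (so elements of $X_N$ are individual functions and $f(x)$ is defined for every $f\in X_N$, $x\in\Omega$). Angle brackets denote the real linear span. We write $X_N\in\mathcal{M}^w(m,2,0)$ if there exist a set of nodes $\{\xi^j\}_{j=1}^m\subset\Omega$ and a set of real weights $\{\lambda_j\}_{j=1}^m$ such that for every $f\in X_N$ $$\int_\Omega f^2\,d\mu=\sum_{j=1}^m\lambda_j f^2(\xi^j).$$ We write $X_N\in\mathcal{M}_+^w(m,2,0)$ if such nodes and weights exist with all weights $\lambda_j$ positive. Define $$m(X_N,w):=\min\{m: X_N\in\mathcal{M}^w(m,2,0)\}.$$ *)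

theory Defs
  imports "HOL-Analysis.Analysis" "HOL-Library.Function_Algebras"
begin

interpretation fun_space: vector_space "\<lambda>(c::real) (f::'a \<Rightarrow> real) x. c * f x"
  by unfold_locales (auto simp: fun_eq_iff algebra_simps)

text \<open>
  A measure \<open>M\<close> carries its domain \<open>\<Omega>\<close> as \<open>space M\<close>. The set \<open>X\<close> is meant to be a
  finite-dimensional space of everywhere defined, square-integrable functions. The nodes form
  an indexed family and are not required to be distinct.
\<close>

definition in_Mw :: "'a measure \<Rightarrow> ('a \<Rightarrow> real) set \<Rightarrow> nat \<Rightarrow> bool" where
  "in_Mw M X m \<longleftrightarrow>
     (\<exists>\<xi> l. (\<forall>j\<in>{1..m}. \<xi> j \<in> space M) \<and>
        (\<forall>f\<in>X. (\<integral>x. (f x)\<^sup>2 \<partial>M) = (\<Sum>j=1..m. l j * (f (\<xi> j))\<^sup>2)))"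

definition in_Mw_pos :: "'a measure \<Rightarrow> ('a \<Rightarrow> real) set \<Rightarrow> nat \<Rightarrow> bool" where
  "in_Mw_pos M X m \<longleftrightarrow>
     (\<exists>\<xi> l. (\<forall>j\<in>{1..m}. \<xi> j \<in> space M \<and> l j > 0) \<and>
        (\<forall>f\<in>X. (\<integral>x. (f x)\<^sup>2 \<partial>M) = (\<Sum>j=1..m. l j * (f (\<xi> j))\<^sup>2)))"

definition min_nodes_w :: "'a measure \<Rightarrow> ('a \<Rightarrow> real) set \<Rightarrow> nat" where
  "min_nodes_w M X = (LEAST m. in_Mw M X m)"

text \<open>Only the values of the following functions on \<open>[-1, 1]\<close> matter.\<close>

definition f1 :: "real \<Rightarrow> real" where
  "f1 x = (if x < 0 then 0 else 1)"

definition f2 :: "real \<Rightarrow> real \<Rightarrow> real \<Rightarrow> real \<Rightarrow> real" where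
  "f2 a A B x =
     (if x < 0 then a
      else if x < 1/4 then A
      else if x < 1/2 then - A
      else if x < 3/4 then B
      else - B)"

definition X2 :: "real \<Rightarrow> real \<Rightarrow> real \<Rightarrow> (real \<Rightarrow> real) set" where
  "X2 a A B = fun_space.span {f1, f2 a A B}"

text \<open>The example satisfies the standing assumptions: the generators are distinct and linearly
  independent already as functions on \<open>[-1, 1]\<close>, and all of \<open>X2\<close> lies in \<open>L\<^sub>2\<close>.\<close>

lemma X2_eq: "X2 a A B = {\<lambda>x. c * f1 x + d * f2 a A B x | c d. True}"
proof -
  have "f \<in> X2 a A B \<longleftrightarrow> (\<exists>c d. \<forall>x. f x - c * f1 x = d * f2 a A B x)" for f
    unfolding X2_def fun_space.span_insert fun_space.span_singleton
    by (auto simp: fun_eq_iff image_iff)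
  then show ?thesis
    by (auto simp: fun_eq_iff algebra_simps)
qed

lemma f1_f2_independent_on:
  assumes "a > 0" "\<forall>x\<in>{-1..1}. c * f1 x + d * f2 a A B x = 0"
  shows "c = 0 \<and> d = 0"
proof -
  have "c * f1 (-1) + d * f2 a A B (-1) = 0" "c * f1 0 + d * f2 a A B 0 = 0"
    using assms(2) by force+
  then show ?thesis using assms(1) by (simp add: f1_def f2_def)
qed

lemma X2_measurable:
  assumes "f \<in> X2 a A B"
  shows "f \<in> borel_measurable borel"
  using assms unfolding X2_eq f1_def f2_def by auto

lemma X2_square_integrable:
  assumes "f \<in> X2 a A B"
  shows "integrable (lebesgue_on {-1..1}) (\<lambda>x. (f x)\<^sup>2)"
proof -
  obtain c d where f: "f = (\<lambda>x. c * f1 x + d * f2 a A B x)"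
    using assms by (auto simp: X2_eq)
  have m: "(\<lambda>x. (f x)\<^sup>2) \<in> borel_measurable (lebesgue_on {-1..1})"
    using X2_measurable[OF assms]
    by (intro measurable_restrict_space1 measurable_completion) auto
  have fin: "finite_measure (lebesgue_on {-1..1::real})"
    by (intro finite_measureI) (simp add: emeasure_restrict_space space_restrict_space)
  have b: "\<bar>f x\<bar> \<le> \<bar>c\<bar> + \<bar>d\<bar> * (\<bar>a\<bar> + \<bar>A\<bar> + \<bar>B\<bar>)" for x
  proof -
    have "\<bar>f2 a A B x\<bar> \<le> \<bar>a\<bar> + \<bar>A\<bar> + \<bar>B\<bar>" "\<bar>f1 x\<bar> \<le> 1" by (auto simp: f1_def f2_def)
    then have "\<bar>c\<bar> * \<bar>f1 x\<bar> + \<bar>d\<bar> * \<bar>f2 a A B x\<bar> \<le> \<bar>c\<bar> * 1 + \<bar>d\<bar> * (\<bar>a\<bar> + \<bar>A\<bar> + \<bar>B\<bar>)"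
      by (intro add_mono mult_left_mono) auto
    then show ?thesis unfolding f using abs_triangle_ineq[of "c * f1 x" "d * f2 a A B x"]
      by (simp add: abs_mult)
  qed
  show ?thesis
    using power_mono[OF b abs_ge_zero, where n = 2]
    by (intro finite_measure.integrable_const_bound[OF fin _ m,
          where B = "(\<bar>c\<bar> + \<bar>d\<bar> * (\<bar>a\<bar> + \<bar>A\<bar> + \<bar>B\<bar>))\<^sup>2"] AE_I2) auto
qed

end

theory Submission
  imports Defs
begin

text \<open>
  An exact quadrature formula for squares on a space spanned by two functions is an identity
  between two quadratic forms in the coefficients \<open>(c, d)\<close>. On \<open>X2\<close> the form on the integral
  side is diagonal, \<open>c\<^sup>2 + G d\<^sup>2\<close> with \<open>G = a\<^sup>2 + (A\<^sup>2 + B\<^sup>2)/2\<close>, since the signs of \<open>f2\<close> balance on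
  \<open>[0, 1]\<close>. Exactness of nodes \<open>\<xi>\<close> and weights \<open>l\<close> therefore amounts to three moment equations
  (\<open>exact_iff_moments\<close>). A node in \<open>[-1, 0)\<close> contributes the vector \<open>(f1, f2) = (0, a)\<close>, a node in
  \<open>[0, 1]\<close> one of \<open>(1, \<plusminus>A)\<close>, \<open>(1, \<plusminus>B)\<close>.

  Everything rests on the position of \<open>G\<close>: the hypothesis \<open>A\<^sup>2 > 2a\<^sup>2 + B\<^sup>2\<close> says exactly that
  \<open>G < A\<^sup>2\<close>, and the arithmetic-geometric mean inequality gives \<open>G > AB > B\<^sup>2\<close>.

  \<^item> Two nodes do not suffice. If one of them lies in \<open>[-1, 0)\<close>, the first two equations force \<open>f2\<close>
    to vanish at the other one, but \<open>f2\<close> has no zero. If both lie in \<open>[0, 1]\<close>, their weights sum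
    to \<open>1\<close> and give the values \<open>y\<^sub>1, y\<^sub>2\<close> of \<open>f2\<close> mean \<open>0\<close>; hence their second moment is
    \<open>- y\<^sub>1 y\<^sub>2\<close>, which is one of \<open>\<plusminus>A\<^sup>2, \<plusminus>AB, \<plusminus>B\<^sup>2\<close> and so differs from \<open>G\<close>.
  \<^item> Three nodes with positive weights do suffice: on the values \<open>A, -A, B\<close> there is a probability
    distribution with mean \<open>0\<close> and second moment \<open>G\<close>. The condition \<open>B\<^sup>2 < G < A\<^sup>2\<close> makes \<open>G\<close> a convex
    combination of \<open>A\<^sup>2\<close> and \<open>B\<^sup>2\<close>, and \<open>G > AB\<close> is exactly what allows the mass on \<open>\<plusminus>A\<close> to
    cancel the mean coming from \<open>B\<close>.
  \<^item> In the formula with the negative weight \<open>l1\<close>, equal weights at the values \<open>\<plusminus>A\<close> already give the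
    first two moments, but the second moment is then \<open>A\<^sup>2 > G\<close>. The node in \<open>[-1, 0)\<close>, where \<open>f1\<close>
    vanishes, removes the excess: \<open>l1 a\<^sup>2 = G - A\<^sup>2 < 0\<close>.
\<close>

section \<open>Quadrature formulas as moment equations\<close>

lemma lebesgue_on_space [simp]: "space (lebesgue_on {-1..1::real}) = {-1..1}"
  by (simp add: space_restrict_space)

text \<open>The cross term \<open>2cd\<close> cancels because \<open>f2\<close> takes the values \<open>\<plusminus>A\<close> and \<open>\<plusminus>B\<close> on intervals of
  equal length.\<close>

lemma integral_square_X2:
  "(\<integral>x. (c * f1 x + d * f2 a A B x)\<^sup>2 \<partial>lebesgue_on {-1..1}) =
     c\<^sup>2 + (a\<^sup>2 + (A\<^sup>2 + B\<^sup>2) / 2) * d\<^sup>2"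
proof -
  let ?M = "lebesgue_on {-1..1::real}"
  have indicator: "has_bochner_integral ?M (\<lambda>x. k * indicat_real S x) (k * measure lebesgue S)"
    if "S \<subseteq> {-1..1}" "S \<in> lmeasurable" for k and S :: "real set"
  proof (intro has_bochner_integral_mult_right)
    have "S \<in> sets ?M" "emeasure ?M S = emeasure lebesgue S" "measure ?M S = measure lebesgue S"
      using that by (auto simp: sets_restrict_space_iff emeasure_restrict_space
          measure_restrict_space fmeasurableD)
    then show "has_bochner_integral ?M (indicat_real S) (measure lebesgue S)"
      using that has_bochner_integral_real_indicator[of S ?M]
      by (auto simp: fmeasurable_def)
  qed
  let ?g = "\<lambda>x. (d * a)\<^sup>2 * indicat_real {-1..<0} x + ((c + d * A)\<^sup>2 * indicat_real {0..<1/4} x +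
     ((c - d * A)\<^sup>2 * indicat_real {1/4..<1/2} x + ((c + d * B)\<^sup>2 * indicat_real {1/2..<3/4} x +
     (c - d * B)\<^sup>2 * indicat_real {3/4..1} x)))"
  have "has_bochner_integral ?M ?g
    ((d * a)\<^sup>2 * measure lebesgue {-1..<0::real} + ((c + d * A)\<^sup>2 * measure lebesgue {0..<1/4::real} +
     ((c - d * A)\<^sup>2 * measure lebesgue {1/4..<1/2::real} +
     ((c + d * B)\<^sup>2 * measure lebesgue {1/2..<3/4::real} +
     (c - d * B)\<^sup>2 * measure lebesgue {3/4..1::real}))))"
    by (intro has_bochner_integral_add indicator)
       (auto intro: bounded_set_imp_lmeasurable)
  then have integral_g: "integral\<^sup>L ?M ?g =
    (d * a)\<^sup>2 * 1 + ((c + d * A)\<^sup>2 * (1/4) +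
     ((c - d * A)\<^sup>2 * (1/4) + ((c + d * B)\<^sup>2 * (1/4) + (c - d * B)\<^sup>2 * (1/4))))"
    by (subst has_bochner_integral_integral_eq) auto
  have "(c * f1 x + d * f2 a A B x)\<^sup>2 = ?g x" if "x \<in> {-1..1}" for x
  proof -
    consider "x < 0" | "0 \<le> x" "x < 1/4" | "1/4 \<le> x" "x < 1/2" | "1/2 \<le> x" "x < 3/4" | "3/4 \<le> x"
      by linarith
    then show ?thesis by cases (use that in \<open>simp_all add: f1_def f2_def indicator_def\<close>)
  qed
  then have "integral\<^sup>L ?M (\<lambda>x. (c * f1 x + d * f2 a A B x)\<^sup>2) = integral\<^sup>L ?M ?g"
    by (intro Bochner_Integration.integral_cong) auto
  also note integral_g
  also have "(d * a)\<^sup>2 * 1 + ((c + d * A)\<^sup>2 * (1/4) +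
     ((c - d * A)\<^sup>2 * (1/4) + ((c + d * B)\<^sup>2 * (1/4) + (c - d * B)\<^sup>2 * (1/4)))) =
     c\<^sup>2 + (a\<^sup>2 + (A\<^sup>2 + B\<^sup>2) / 2) * d\<^sup>2"
    by (simp add: power2_eq_square field_simps)
  finally show ?thesis .
qed

text \<open>Both sides are quadratic forms in the coefficients of \<open>f\<close>, so exactness on \<open>X2\<close> is equality of
  their three coefficients.\<close>

lemma exact_iff_moments:
  "(\<forall>f\<in>X2 a A B. (\<integral>x. (f x)\<^sup>2 \<partial>lebesgue_on {-1..1}) = (\<Sum>j\<in>J. l j * (f (\<xi> j))\<^sup>2)) \<longleftrightarrow>
     (\<Sum>j\<in>J. l j * (f1 (\<xi> j))\<^sup>2) = 1 \<and>
     (\<Sum>j\<in>J. l j * (f1 (\<xi> j) * f2 a A B (\<xi> j))) = 0 \<and>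
     (\<Sum>j\<in>J. l j * (f2 a A B (\<xi> j))\<^sup>2) = a\<^sup>2 + (A\<^sup>2 + B\<^sup>2) / 2"
  (is "?exact \<longleftrightarrow> ?P = 1 \<and> ?Q = 0 \<and> ?R = ?G")
proof -
  have expand: "(\<Sum>j\<in>J. l j * (c * f1 (\<xi> j) + d * f2 a A B (\<xi> j))\<^sup>2) =
      c\<^sup>2 * ?P + 2 * c * d * ?Q + d\<^sup>2 * ?R" for c d
    by (simp add: sum_distrib_left sum.distrib[symmetric] power2_eq_square algebra_simps)
  have "?exact \<longleftrightarrow> (\<forall>c d. c\<^sup>2 + ?G * d\<^sup>2 = c\<^sup>2 * ?P + 2 * c * d * ?Q + d\<^sup>2 * ?R)"
    unfolding expand[symmetric] integral_square_X2[symmetric] by (auto simp: X2_eq)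
  also have "\<dots> \<longleftrightarrow> ?P = 1 \<and> ?Q = 0 \<and> ?R = ?G"
  proof
    assume eq: "\<forall>c d. c\<^sup>2 + ?G * d\<^sup>2 = c\<^sup>2 * ?P + 2 * c * d * ?Q + d\<^sup>2 * ?R"
    show "?P = 1 \<and> ?Q = 0 \<and> ?R = ?G"
      using eq[rule_format, of 1 0] eq[rule_format, of 0 1] eq[rule_format, of 1 1] by simp
  qed simp
  finally show ?thesis .
qed

section \<open>Two nodes do not suffice\<close>

lemma in_Mw_mono:
  assumes "in_Mw M X m" "m \<le> n" "space M \<noteq> {}"
  shows "in_Mw M X n"
proof -
  obtain \<xi> l where \<xi>: "\<forall>j\<in>{1..m}. \<xi> j \<in> space M"
    and l: "\<forall>f\<in>X. (\<integral>x. (f x)\<^sup>2 \<partial>M) = (\<Sum>j=1..m. l j * (f (\<xi> j))\<^sup>2)"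
    using assms(1) unfolding in_Mw_def by blast
  obtain z where z: "z \<in> space M" using assms(3) by blast
  \<comment> \<open>Pad with copies of \<open>z\<close> of weight \<open>0\<close>.\<close>
  let ?\<xi> = "\<lambda>j. if j \<le> m then \<xi> j else z" and ?l = "\<lambda>j. if j \<le> m then l j else 0"
  have "(\<Sum>j=1..n. ?l j * (f (?\<xi> j))\<^sup>2) = (\<Sum>j=1..m. l j * (f (\<xi> j))\<^sup>2)" for f
    using assms(2) by (intro sum.mono_neutral_cong_right) auto
  then show ?thesis
    unfolding in_Mw_def using \<xi> l z by (intro exI[of _ ?\<xi>] exI[of _ ?l]) auto
qed

text \<open>Both values are roots of \<open>y\<^sup>2 - (y\<^sub>1 + y\<^sub>2) y + y\<^sub>1 y\<^sub>2\<close>. Averaging this relation with total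
  weight \<open>1\<close> and mean \<open>0\<close> removes the linear term and gives the second moment.\<close>

lemma second_moment_two_points:
  fixes p q y1 y2 :: real
  assumes "p + q = 1" "p * y1 + q * y2 = 0"
  shows "p * y1\<^sup>2 + q * y2\<^sup>2 = - (y1 * y2)"
proof -
  have "p * y1\<^sup>2 + q * y2\<^sup>2 = (y1 + y2) * (p * y1 + q * y2) - (p + q) * (y1 * y2)"
    by (simp add: power2_eq_square algebra_simps)
  then show ?thesis using assms by simp
qed

lemma second_moment_bounds:
  fixes a A B :: real
  assumes "a > 0" "A > B" "B > 0" "A\<^sup>2 > 2 * a\<^sup>2 + B\<^sup>2"
  defines "G \<equiv> a\<^sup>2 + (A\<^sup>2 + B\<^sup>2) / 2"
  shows "B\<^sup>2 < A * B" "A * B < G" "G < A\<^sup>2"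
proof -
  show "B\<^sup>2 < A * B" using assms by (simp add: power2_eq_square)
  have "(A - B)\<^sup>2 > 0" "a\<^sup>2 > 0" using assms by auto
  then have "2 * (A * B) < 2 * a\<^sup>2 + (A\<^sup>2 + B\<^sup>2)" unfolding power2_diff mult.assoc by linarith
  then show "A * B < G" by (simp add: G_def field_simps)
  show "G < A\<^sup>2" using assms by (simp add: G_def field_simps)
qed

lemma X2_not_in_Mw_2:
  fixes a A B :: real
  assumes "a > 0" "A > B" "B > 0" "A\<^sup>2 > 2 * a\<^sup>2 + B\<^sup>2"
  shows "\<not> in_Mw (lebesgue_on {-1..1}) (X2 a A B) 2"
proof
  let ?G = "a\<^sup>2 + (A\<^sup>2 + B\<^sup>2) / 2"
  assume "in_Mw (lebesgue_on {-1..1}) (X2 a A B) 2"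
  then obtain \<xi> :: "nat \<Rightarrow> real" and l where
    mom: "(\<Sum>j=1..2. l j * (f1 (\<xi> j))\<^sup>2) = 1"
      "(\<Sum>j=1..2. l j * (f1 (\<xi> j) * f2 a A B (\<xi> j))) = 0"
      "(\<Sum>j=1..2. l j * (f2 a A B (\<xi> j))\<^sup>2) = ?G"
    unfolding in_Mw_def exact_iff_moments by blast
  let ?y1 = "f2 a A B (\<xi> 1)" and ?y2 = "f2 a A B (\<xi> 2)"
  have sum2: "(\<Sum>j=1..2. h j) = h 1 + h 2" for h :: "nat \<Rightarrow> real"
    by (simp add: numeral_2_eq_2)
  have nonzero: "f2 a A B x \<noteq> 0" for x using assms by (simp add: f2_def)
  have values_nonneg: "f2 a A B x \<in> {A, -A, B, -B}" if "x \<ge> 0" for x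
    using that by (simp add: f2_def)
  show False
  proof (cases "\<xi> 1 < 0 \<or> \<xi> 2 < 0")
    case True
    then show False
      using mom(1,2) nonzero[of "\<xi> 1"] nonzero[of "\<xi> 2"]
      unfolding sum2 by (auto simp: f1_def split: if_splits)
  next
    case False
    then have "l 1 + l 2 = 1" "l 1 * ?y1 + l 2 * ?y2 = 0" "l 1 * ?y1\<^sup>2 + l 2 * ?y2\<^sup>2 = ?G"
      using mom unfolding sum2 by (simp_all add: f1_def)
    then have G: "?G = - (?y1 * ?y2)"
      using second_moment_two_points[of "l 1" "l 2" ?y1 ?y2] by linarith
    have "?y1 \<in> {A, -A, B, -B}" "?y2 \<in> {A, -A, B, -B}" using False values_nonneg by auto
    then have "- (?y1 * ?y2) \<in> {A\<^sup>2, - A\<^sup>2, A * B, - (A * B), B\<^sup>2, - B\<^sup>2}"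
      by (auto simp: power2_eq_square mult.commute)
    then have "?G \<in> {A\<^sup>2, - A\<^sup>2, A * B, - (A * B), B\<^sup>2, - B\<^sup>2}" unfolding G .
    moreover have "B\<^sup>2 > 0" using assms by simp
    ultimately show False
      using second_moment_bounds[OF assms] by (elim insertE emptyE) linarith+
  qed
qed

section \<open>Three positive weights suffice\<close>

text \<open>The mass \<open>r\<close> at \<open>B\<close> is fixed by the second moment, and the remaining mass \<open>1 - r\<close> is split
  between \<open>A\<close> and \<open>-A\<close> so that the mean vanishes. The smaller of the two parts, at \<open>A\<close>, is
  positive iff \<open>r (A + B) < A\<close>, which is equivalent to \<open>G > AB\<close>.\<close>

lemma positive_weights_three_points:
  fixes A B G :: real
  assumes "0 < B" "B < A" "A * B < G" "G < A\<^sup>2"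
  obtains p q r :: real where "p > 0" "q > 0" "r > 0" "p + q + r = 1"
    "p * A - q * A + r * B = 0" "(p + q) * A\<^sup>2 + r * B\<^sup>2 = G"
proof -
  define r where "r = (A\<^sup>2 - G) / (A\<^sup>2 - B\<^sup>2)"
  define p where "p = ((1 - r) - r * B / A) / 2"
  define q where "q = ((1 - r) + r * B / A) / 2"
  have D: "A\<^sup>2 - B\<^sup>2 = (A - B) * (A + B)" by (simp add: power2_eq_square algebra_simps)
  have pos: "A - B > 0" "A + B > 0" "A > 0" using assms by auto
  have "r > 0" using assms pos by (simp add: r_def D)
  have "r * (A + B) = (A\<^sup>2 - G) / (A - B)" using pos by (simp add: r_def D)
  also have "\<dots> < A"
    using assms pos by (simp add: pos_divide_less_eq power2_eq_square algebra_simps)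
  finally have "(1 - r) - r * B / A > 0"
    using pos by (simp add: field_simps)
  then have "p > 0" by (simp add: p_def)
  moreover have "r * B / A > 0" using \<open>r > 0\<close> assms pos by simp
  ultimately have "q > 0" unfolding p_def q_def by (simp add: field_simps)
  have pq: "p + q = 1 - r" by (simp add: p_def q_def field_simps)
  then have "p + q + r = 1" by simp
  have "p * A - q * A + r * B = 0" using pos by (simp add: p_def q_def field_simps)
  have "r * (A\<^sup>2 - B\<^sup>2) = A\<^sup>2 - G" using pos by (simp add: r_def D)
  then have "(p + q) * A\<^sup>2 + r * B\<^sup>2 = G" unfolding pq by (simp add: algebra_simps)
  show ?thesis by (rule that) fact+
qed

lemma X2_in_Mw_pos_3:
  fixes a A B :: real
  assumes "a > 0" "A > B" "B > 0" "A\<^sup>2 > 2 * a\<^sup>2 + B\<^sup>2"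
  shows "in_Mw_pos (lebesgue_on {-1..1}) (X2 a A B) 3"
proof -
  obtain p q r where w: "p > 0" "q > 0" "r > 0" "p + q + r = 1" "p * A - q * A + r * B = 0"
    "(p + q) * A\<^sup>2 + r * B\<^sup>2 = a\<^sup>2 + (A\<^sup>2 + B\<^sup>2) / 2"
    using positive_weights_three_points second_moment_bounds[OF assms] assms by metis
  \<comment> \<open>Nodes at which \<open>f2\<close> equals \<open>A\<close>, \<open>-A\<close> and \<open>B\<close>.\<close>
  define \<xi> :: "nat \<Rightarrow> real" where "\<xi> j = (if j = 1 then 1/8 else if j = 2 then 3/8 else 5/8)" for j
  define l :: "nat \<Rightarrow> real" where "l j = (if j = 1 then p else if j = 2 then q else r)" for j
  have "\<forall>j\<in>{1..3}. \<xi> j \<in> space (lebesgue_on {-1..1}) \<and> l j > 0"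
    using w by (auto simp: \<xi>_def l_def)
  moreover have "\<forall>f\<in>X2 a A B. (\<integral>x. (f x)\<^sup>2 \<partial>lebesgue_on {-1..1}) =
      (\<Sum>j=1..3. l j * (f (\<xi> j))\<^sup>2)"
    unfolding exact_iff_moments using w
    by (simp add: numeral_3_eq_3 \<xi>_def l_def f1_def f2_def algebra_simps)
  ultimately show ?thesis unfolding in_Mw_pos_def by blast
qed

lemma in_Mw_pos_imp_in_Mw: "in_Mw_pos M X m \<Longrightarrow> in_Mw M X m"
  unfolding in_Mw_pos_def in_Mw_def by blast

theorem theorem1:
  fixes a A B :: real
  assumes "a > 0" and "A > B" and "B > 0" and "A\<^sup>2 > 2 * a\<^sup>2 + B\<^sup>2"
  shows "min_nodes_w (lebesgue_on {-1..1}) (X2 a A B) = 3 \<and>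
    in_Mw_pos (lebesgue_on {-1..1}) (X2 a A B) 3 \<and>
    (let l1 = (2 * a\<^sup>2 - A\<^sup>2 + B\<^sup>2) / (2 * a\<^sup>2) in
      l1 < 0 \<and>
      (\<forall>f\<in>X2 a A B. (\<integral>x. (f x)\<^sup>2 \<partial>lebesgue_on {-1..1}) =
         l1 * (f (-1/2))\<^sup>2 + 1/2 * (f (1/8))\<^sup>2 + 1/2 * (f (3/8))\<^sup>2))"
proof -
  let ?M = "lebesgue_on {-1..1::real}" and ?X = "X2 a A B"
  have pos: "in_Mw_pos ?M ?X 3" by (rule X2_in_Mw_pos_3[OF assms])
  have "3 \<le> m" if "in_Mw ?M ?X m" for m
    using in_Mw_mono[OF that, of 2] X2_not_in_Mw_2[OF assms] by fastforce
  then have min: "min_nodes_w ?M ?X = 3"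
    unfolding min_nodes_w_def using in_Mw_pos_imp_in_Mw[OF pos] by (intro Least_equality) auto
  define l1 where "l1 = (2 * a\<^sup>2 - A\<^sup>2 + B\<^sup>2) / (2 * a\<^sup>2)"
  have neg: "l1 < 0" using assms by (simp add: l1_def divide_neg_pos)
  have l1: "l1 * a\<^sup>2 = a\<^sup>2 + (B\<^sup>2 - A\<^sup>2) / 2" using assms by (simp add: l1_def field_simps)
  have "(\<integral>x. (f x)\<^sup>2 \<partial>?M) = l1 * (f (-1/2))\<^sup>2 + 1/2 * (f (1/8))\<^sup>2 + 1/2 * (f (3/8))\<^sup>2"
    if f_in: "f \<in> ?X" for f
  proof -
    obtain c d where f: "f = (\<lambda>x. c * f1 x + d * f2 a A B x)"
      using f_in by (auto simp: X2_eq)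
    have "l1 * (f (-1/2))\<^sup>2 + 1/2 * (f (1/8))\<^sup>2 + 1/2 * (f (3/8))\<^sup>2 =
        c\<^sup>2 + (l1 * a\<^sup>2 + A\<^sup>2) * d\<^sup>2"
      by (simp add: f f1_def f2_def power2_eq_square algebra_simps)
    also have "\<dots> = (\<integral>x. (f x)\<^sup>2 \<partial>?M)"
      unfolding l1 f integral_square_X2 by (simp add: field_simps)
    finally show ?thesis by simp
  qed
  then show ?thesis using min pos neg by (simp add: Let_def l1_def)
qed

end
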